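(* Let $\delta,a,K\in\mathbb{N}$ satisfy $2\le a\le K-2$, let $f$ be a bistable reaction function with viability constant $a$ and capacity $K$, and let $F$ be the update rule of the bistable reaction-diffusion cellular automaton determined by $\delta$ and $f$. There exists a right traveling wave with $c=1$, i.e. a wave profile $w$ with $F(w)_n=w_{n-1}$ for all $n\in\mathbb{Z}$, if and only if $a>\frac{K}{2}$ and there exists $p\in\left[\frac{K}{2},a\right)_{\mathbb{Z}}$ satisfying $$\delta\ge K-p\qquad\text{and}\qquad f(p)\le 2p-K.$$
   Context: $\mathbb{N}=\{1,2,\dots\}$, $\mathbb{N}_0=\mathbb{N}\cup\{0\}$; a subscript $\mathbb{Z}$ on an interval denotes its intersection with $\mathbb{Z}$, e.g. $(0,a)_{\mathbb{Z}}=(0,a)\cap\mathbb{Z}$. For $\delta\in\mathbb{N}$ define $h_\delta(m,n)\in\mathbb{Z}$ for $m,n\in\mathbb{N}_0$ by: $h_\delta(m,n)=\delta$ if $m-n\ge 2\delta$; $h_\delta(m,n)=-\delta$ if $m-n\le -2\delta$; for $j=1,\dots,\delta-1$, $h_\delta(m,n)=j$ if $m-n\in\{2j,2j+1\}$ and $h_\delta(m,n)=-j$ if $n-m\in\{2j,2j+1\}$; and $h_\delta(m,n)=0$ otherwise. For integers $a,K$ with $2\le a\le K-2$, a bistable reaction function with viability constant $a$ and capacity $K$ is a nondecreasing $f:\mathbb{N}_0\to\mathbb{N}_0$ with $f(0)=0$, $f(a)=a$, $f(K)=K$, $f(u)\in[0,u)_{\mathbb{Z}}$ for $u\in(0,a)_{\mathbb{Z}}$,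 $f(u)\in(u,K]_{\mathbb{Z}}$ for $u\in(a,K)_{\mathbb{Z}}$, and $f(u)\in[K,u)_{\mathbb{Z}}$ for $u\in(K,\infty)_{\mathbb{Z}}$. The bistable reaction-diffusion cellular automaton determined by $\delta$ and $f$ is $u(t+1)=F(u(t))$, $t\in\mathbb{N}_0$, where for $u\in\mathbb{N}_0^{\mathbb{Z}}$, $n\in\mathbb{Z}$, $$F(u)_n=f(u_n)+h_\delta(f(u_{n-1}),f(u_n))+h_\delta(f(u_{n+1}),f(u_n)).$$ A wave profile is a sequence $w=(w_n)_{n\in\mathbb{Z}}$ of nonnegative integers for which there is $N\in\mathbb{N}$ with $w_n=0$ for $n\le 0$, $w_n=K$ for $n\ge N$, and $0=w_0<w_1\le w_2\le\dots\le w_{N-1}<w_N=K$. *)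

theory Defs
  imports Complex_Main
begin

definition h_flux :: "nat \<Rightarrow> nat \<Rightarrow> nat \<Rightarrow> int" where
  "h_flux \<delta> m n =
    (let d = int m - int n in
     if d \<ge> 2 * int \<delta> then int \<delta>
     else if d \<le> - (2 * int \<delta>) then - int \<delta>
     else if \<exists>j\<in>{1..int \<delta> - 1}. d \<in> {2 * j, 2 * j + 1}
       then (THE j. j \<in> {1..int \<delta> - 1} \<and> d \<in> {2 * j, 2 * j + 1})
     else if \<exists>j\<in>{1..int \<delta> - 1}. - d \<in> {2 * j, 2 * j + 1}
       then - (THE j. j \<in> {1..int \<delta> - 1} \<and> - d \<in> {2 * j, 2 * j + 1})
     else 0)"

lemma h_flux_the:
  fixes d D :: int
  assumes "j \<in> {1..D - 1}" "d \<in> {2 * j, 2 * j + 1}"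
  shows "(THE j. j \<in> {1..D - 1} \<and> d \<in> {2 * j, 2 * j + 1}) = j"
  using assms by (intro the_equality) auto

lemma h_flux_pos:
  assumes "j \<in> {1..int \<delta> - 1}" "int m - int n \<in> {2 * j, 2 * j + 1}"
  shows "h_flux \<delta> m n = j"
proof -
  have "\<not> int m - int n \<ge> 2 * int \<delta>" "\<not> int m - int n \<le> - (2 * int \<delta>)"
    using assms by auto
  moreover have "\<exists>j\<in>{1..int \<delta> - 1}. int m - int n \<in> {2 * j, 2 * j + 1}"
    using assms by blast
  ultimately show ?thesis
    unfolding h_flux_def Let_def by (simp only: if_False if_True h_flux_the[OF assms])
qed

lemma h_flux_neg:
  assumes j: "j \<in> {1..int \<delta> - 1}" and d: "int n - int m \<in> {2 * j, 2 * j + 1}"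
  shows "h_flux \<delta> m n = - j"
proof -
  have d': "- (int m - int n) \<in> {2 * j, 2 * j + 1}"
    using d by auto
  have "\<not> int m - int n \<ge> 2 * int \<delta>" "\<not> int m - int n \<le> - (2 * int \<delta>)"
    "\<not> (\<exists>j\<in>{1..int \<delta> - 1}. int m - int n \<in> {2 * j, 2 * j + 1})"
    using j d by auto
  moreover have "\<exists>j\<in>{1..int \<delta> - 1}. - (int m - int n) \<in> {2 * j, 2 * j + 1}"
    using j d' by blast
  ultimately show ?thesis
    unfolding h_flux_def Let_def by (simp only: if_False if_True h_flux_the[OF j d'])
qed

lemma h_flux_eq_div:
  assumes "\<delta> \<ge> 1"
  shows "h_flux \<delta> m n =
    (if m \<ge> n then min (int \<delta>) ((int m - int n) div 2)
     else - min (int \<delta>) ((int n - int m) div 2))"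
proof -
  define d where "d = int m - int n"
  consider "d \<ge> 2 * int \<delta>" | "d \<le> - (2 * int \<delta>)" "d < 2 * int \<delta>"
    | "2 \<le> d" "d < 2 * int \<delta>" | "2 \<le> - d" "- d < 2 * int \<delta>" | "\<bar>d\<bar> \<le> 1" "\<bar>d\<bar> < 2 * int \<delta>"
    by linarith
  then show ?thesis
  proof cases
    case 1
    then have "h_flux \<delta> m n = int \<delta>" by (simp add: h_flux_def d_def)
    moreover have "d div 2 \<ge> int \<delta>" "m \<ge> n" using 1 by (auto simp: d_def)
    ultimately show ?thesis by (simp add: d_def)
  next
    case 2
    then have "h_flux \<delta> m n = - int \<delta>" by (simp add: h_flux_def d_def)
    moreover have "(- d) div 2 \<ge> int \<delta>" "\<not> m \<ge> n" using 2 assms by (auto simp: d_def)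
    ultimately show ?thesis by (simp add: d_def)
  next
    case 3
    have "d div 2 \<in> {1..int \<delta> - 1}" "d = 2 * (d div 2) \<or> d = 2 * (d div 2) + 1"
      using 3 by auto
    then have "h_flux \<delta> m n = d div 2"
      by (intro h_flux_pos) (auto simp: d_def)
    moreover have "d div 2 \<le> int \<delta>" "m \<ge> n" using 3 by (auto simp: d_def)
    ultimately show ?thesis by (simp add: d_def)
  next
    case 4
    define e where "e = - d"
    have "e div 2 \<in> {1..int \<delta> - 1}" "e = 2 * (e div 2) \<or> e = 2 * (e div 2) + 1"
      using 4 by (auto simp: e_def)
    moreover have "int n - int m = e"
      by (simp add: d_def e_def)
    ultimately have "h_flux \<delta> m n = - ((- d) div 2)"
      using h_flux_neg[of "e div 2" \<delta> n m] by (auto simp: e_def)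
    moreover have "(- d) div 2 \<le> int \<delta>" "\<not> m \<ge> n" using 4 by (auto simp: d_def)
    ultimately show ?thesis by (simp add: d_def)
  next
    case 5
    then have "h_flux \<delta> m n = 0" using assms by (auto simp: h_flux_def Let_def d_def)
    moreover have "d \<in> {- 1, 0, 1}" using 5 by auto
    ultimately show ?thesis using assms by (auto simp: d_def)
  qed
qed

definition bistable_reaction :: "nat \<Rightarrow> nat \<Rightarrow> (nat \<Rightarrow> nat) \<Rightarrow> bool" where
  "bistable_reaction a K f \<longleftrightarrow>
     mono f \<and> f 0 = 0 \<and> f a = a \<and> f K = K \<and>
     (\<forall>u\<in>{0<..<a}. f u \<in> {0..<u}) \<and>
     (\<forall>u\<in>{a<..<K}. f u \<in> {u<..K}) \<and>
     (\<forall>u\<in>{K<..}. f u \<in> {K..<u})"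

(* The value is an integer because the fluxes may be negative. The new state
   itself is never negative, by ca_update_nonneg below. *)
definition ca_update :: "nat \<Rightarrow> (nat \<Rightarrow> nat) \<Rightarrow> (int \<Rightarrow> nat) \<Rightarrow> int \<Rightarrow> int" where
  "ca_update \<delta> f u n =
     int (f (u n)) + h_flux \<delta> (f (u (n - 1))) (f (u n)) + h_flux \<delta> (f (u (n + 1))) (f (u n))"

lemma ca_update_nonneg:
  assumes "\<delta> \<ge> 1"
  shows "ca_update \<delta> f u n \<ge> 0"
proof -
  have "2 * h_flux \<delta> m k \<ge> - int k" for m k
  proof (cases "m \<ge> k")
    case True
    then have "h_flux \<delta> m k \<ge> 0" by (simp add: h_flux_eq_div[OF assms])
    then show ?thesis by simp
  next
    case False
    then have "h_flux \<delta> m k \<ge> - ((int k - int m) div 2)" by (simp add: h_flux_eq_div[OF assms])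
    then show ?thesis by linarith
  qed
  from this[where m = "f (u (n - 1))" and k = "f (u n)"]
    this[where m = "f (u (n + 1))" and k = "f (u n)"]
  show ?thesis unfolding ca_update_def by linarith
qed

(* For N = 1 the chain 0 = w 0 < w 1 \<le> ... \<le> w (N - 1) < w N = K
   degenerates to 0 = w 0 < w 1 = K. *)
definition wave_profile :: "nat \<Rightarrow> (int \<Rightarrow> nat) \<Rightarrow> bool" where
  "wave_profile K w \<longleftrightarrow>
     (\<exists>N\<ge>1. (\<forall>n\<le>0. w n = 0) \<and> (\<forall>n\<ge>N. w n = K) \<and>
        w 0 < w 1 \<and> (\<forall>n. 1 \<le> n \<and> n < N - 1 \<longrightarrow> w n \<le> w (n + 1)) \<and> w (N - 1) < w N)"

end

theory Submission
  imports Defs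
begin

text \<open>
  Let \<open>w\<close> be nondecreasing, put \<open>v n = f (w n)\<close>, and let \<open>J n\<close> be the flux
  across the edge between \<open>n\<close> and \<open>n + 1\<close>, which is \<open>half_capped \<delta> (v (n + 1) - v n)\<close>.
  The wave equation with \<open>c = 1\<close> is then the conservation law
  \<open>w (n - 1) + J (n - 1) = v n + J n\<close>, so both sides are the same quantity \<open>E n\<close>, and
  \<open>E (n + 1) - E n = w n - f (w n)\<close>. Hence \<open>E\<close> cannot fall where
  \<open>w < a\<close> and cannot rise where \<open>a \<le> w \<le> K\<close>.

  Necessity. Let \<open>M\<close> be the last index with \<open>w M < a\<close>. Beyond \<open>M\<close> the quantity \<open>E\<close> never rises
  and it ends at \<open>K\<close>, so \<open>E (M + 1) \<ge> K\<close>. But \<open>E n\<close> is at most the mean of \<open>v n\<close> and \<open>v (n + 1)\<close>, so a value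
  of \<open>K\<close> forces \<open>v (M + 1) = K\<close>. With \<open>p = w M\<close> the conservation law at \<open>M + 1\<close> reads
  \<open>p + half_capped \<delta> (K - f p) = K\<close>, which yields both inequalities for \<open>p\<close>
  (\<open>wave_has_front_value\<close>, \<open>front_value_iff\<close>).

  Sufficiency. The profile is built from right to left, starting with \<open>K\<close>. Given \<open>v n\<close> and \<open>J n\<close>,
  the value \<open>w (n - 1) = y\<close> has to satisfy \<open>y + half_capped \<delta> (v n - f y) = v n + J n\<close>. As \<open>f\<close> is
  nondecreasing, the left side rises by at most one when \<open>y\<close> does, so a discrete intermediate value
  argument solves this equation exactly (\<open>flux_equation_solvable\<close>). The invariant \<open>J n \<le> w n - v n\<close>
  guarantees that the target lies in the attained range and it reproduces itself
  (\<open>backward_step\<close>). Positive values strictly drop every two steps, because a repeated value has zero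
  flux and a positive value below \<open>a\<close> is not fixed by \<open>f\<close>; so they reach \<open>0\<close>, and the profile is
  placed so that its first zero, counted from the right, is at the origin.
\<close>

section \<open>The flux across an edge of a nondecreasing profile\<close>

definition half_capped :: "nat \<Rightarrow> int \<Rightarrow> int" where
  "half_capped \<delta> d = min (int \<delta>) (d div 2)"

lemma half_capped_0 [simp]: "half_capped \<delta> 0 = 0"
  by (simp add: half_capped_def)

lemma half_capped_nonneg: "0 \<le> d \<Longrightarrow> 0 \<le> half_capped \<delta> d"
  by (simp add: half_capped_def)

lemma double_half_capped_le: "2 * half_capped \<delta> d \<le> d"
  unfolding half_capped_def by linarith

lemma half_capped_mono: "d \<le> e \<Longrightarrow> half_capped \<delta> d \<le> half_capped \<delta> e"
  unfolding half_capped_def by (intro min.mono zdiv_mono1) auto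

lemma ca_update_eq_half_capped:
  assumes "\<delta> \<ge> 1" "f (u (n - 1)) \<le> f (u n)" "f (u n) \<le> f (u (n + 1))"
  shows "ca_update \<delta> f u n = int (f (u n))
    + half_capped \<delta> (int (f (u (n + 1))) - int (f (u n)))
    - half_capped \<delta> (int (f (u n)) - int (f (u (n - 1))))"
  using assms by (auto simp: ca_update_def h_flux_eq_div half_capped_def)

section \<open>Discrete intermediate values\<close>

text \<open>Only upward jumps have to be small: the first index at which \<open>G\<close> is at least \<open>T\<close> is entered
  from below, so it cannot overshoot.\<close>

lemma discrete_intermediate_value:
  fixes G :: "nat \<Rightarrow> int"
  assumes "\<And>i. G (Suc i) \<le> G i + 1" "G 0 \<le> T" "T \<le> G x"
  shows "\<exists>y\<le>x. G y = T"
  using assms(3)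
proof (induction x)
  case 0
  then show ?case using assms(2) by auto
next
  case (Suc x)
  show ?case
  proof (cases "T \<le> G x")
    case True
    then show ?thesis using Suc.IH by (meson le_Suc_eq)
  next
    case False
    then have "G (Suc x) = T" using assms(1)[of x] Suc.prems by linarith
    then show ?thesis by blast
  qed
qed

lemma flux_equation_solvable:
  fixes f :: "nat \<Rightarrow> nat" and c T :: int
  assumes "mono f" "half_capped \<delta> (c - int (f 0)) \<le> T"
    and "T \<le> int x + half_capped \<delta> (c - int (f x))"
  shows "\<exists>y\<le>x. int y + half_capped \<delta> (c - int (f y)) = T"
proof (rule discrete_intermediate_value)
  fix i
  have "half_capped \<delta> (c - int (f (Suc i))) \<le> half_capped \<delta> (c - int (f i))"
    using monoD[OF \<open>mono f\<close>, of i "Suc i"] by (intro half_capped_mono) simp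
  then show "int (Suc i) + half_capped \<delta> (c - int (f (Suc i)))
      \<le> int i + half_capped \<delta> (c - int (f i)) + 1"
    by simp
qed (use assms in auto)

section \<open>The value just behind the front\<close>

lemma front_value_iff:
  fixes f :: "nat \<Rightarrow> nat"
  shows "int K \<le> int p + half_capped \<delta> (int K - int (f p)) \<longleftrightarrow>
    real K / 2 \<le> real p \<and> int \<delta> \<ge> int K - int p \<and> int (f p) \<le> 2 * int p - int K"
proof -
  have "int K \<le> int p + half_capped \<delta> (int K - int (f p)) \<longleftrightarrow>
      int \<delta> \<ge> int K - int p \<and> int (f p) \<le> 2 * int p - int K"
    by (auto simp: half_capped_def min_def)
  moreover have "real K / 2 \<le> real p" if "int (f p) \<le> 2 * int p - int K"
    using that by linarith
  ultimately show ?thesis by blast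
qed

lemma wave_profile_mono:
  assumes "wave_profile K w"
  shows "mono w"
proof -
  obtain N where N: "N \<ge> 1" "\<forall>n\<le>0. w n = 0" "\<forall>n\<ge>N. w n = K" "w 0 < w 1"
    "\<forall>n. 1 \<le> n \<and> n < N - 1 \<longrightarrow> w n \<le> w (n + 1)" "w (N - 1) < w N"
    using assms unfolding wave_profile_def by blast
  have step: "w n \<le> w (n + 1)" for n
  proof -
    consider "n \<le> -1" | "n = 0" | "1 \<le> n" "n < N - 1" | "n = N - 1" | "n \<ge> N"
      by linarith
    then show ?thesis by cases (use N in auto)
  qed
  have "w m \<le> w (m + int k)" for m k
  proof (induction k)
    case (Suc k)
    then show ?case using step[of "m + int k"] by (simp add: algebra_simps)
  qed simp
  then have "w m \<le> w n" if "m \<le> n" for m n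
    using that by (metis zle_iff_zadd)
  then show ?thesis by (rule monoI)
qed

text \<open>This is the necessity argument. The rightmost value below \<open>a\<close> is the required \<open>p\<close>.\<close>

lemma wave_has_front_value:
  assumes "\<delta> \<ge> 1" and "0 < a" and "a < K" and bis: "bistable_reaction a K f"
    and wp: "wave_profile K w" and wave: "\<And>n. ca_update \<delta> f w n = int (w (n - 1))"
  shows "\<exists>p<a. int K \<le> int p + half_capped \<delta> (int K - int (f p))"
proof -
  obtain N where N0: "\<And>n. n \<le> 0 \<Longrightarrow> w n = 0" and NK: "\<And>n. n \<ge> N \<Longrightarrow> w n = K"
    using wp unfolding wave_profile_def by blast
  have mono_w: "w m \<le> w n" if "m \<le> n" for m n
    using monoD[OF wave_profile_mono[OF wp] that] .
  have w_le: "w n \<le> K" for n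
    using mono_w[of n "max n N"] NK[of "max n N"] by simp
  have f: "mono f" "f a = a" "f K = K" "\<And>u. a < u \<Longrightarrow> u < K \<Longrightarrow> u < f u"
    using bis by (auto simp: bistable_reaction_def)
  define v where "v n = int (f (w n))" for n
  define J where "J n = half_capped \<delta> (v (n + 1) - v n)" for n
  have v_mono: "v m \<le> v n" if "m \<le> n" for m n
    using monoD[OF f(1) mono_w[OF that]] by (simp add: v_def)
  have v_le: "v n \<le> int K" for n
    using monoD[OF f(1) w_le[of n]] f(3) by (simp add: v_def)
  have conservation: "v n + J n = int (w (n - 1)) + J (n - 1)" for n
  proof -
    have "f (w (n - 1)) \<le> f (w n)" "f (w n) \<le> f (w (n + 1))"
      using v_mono[of "n - 1" n] v_mono[of n "n + 1"] by (simp_all add: v_def)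
    then show ?thesis
      using ca_update_eq_half_capped[OF \<open>\<delta> \<ge> 1\<close>, of f w n] wave[of n]
      by (simp add: J_def v_def)
  qed
  \<comment> \<open>Values from \<open>a\<close> to \<open>K\<close> are not decreased by \<open>f\<close>, so \<open>v + J\<close> never rises to the right of \<open>M\<close>.\<close>
  obtain M where M: "w M < a" "\<And>n. n > M \<Longrightarrow> a \<le> w n"
  proof -
    have bounded: "n < N" if "w n < a" for n
      using NK[of n] that \<open>a < K\<close> by (cases "n < N") auto
    define S where "S = {n. 0 \<le> n \<and> w n < a}"
    have "S \<subseteq> {0..<N}" using bounded by (auto simp: S_def)
    then have "finite S" by (rule finite_subset) simp
    moreover have "0 \<in> S" using N0 \<open>0 < a\<close> by (simp add: S_def)
    ultimately have Max_S: "Max S \<in> S" "\<And>n. n \<in> S \<Longrightarrow> n \<le> Max S" "0 \<le> Max S"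
      by (auto intro: Max_in)
    moreover have "a \<le> w n" if "n > Max S" for n
    proof (rule ccontr)
      assume "\<not> a \<le> w n"
      then have "n \<in> S" using that Max_S(3) by (simp add: S_def)
      then show False using Max_S(2)[of n] that by simp
    qed
    ultimately show thesis
      using Max_S(1) that[of "Max S"] by (simp add: S_def)
  qed
  have "w n \<le> f (w n)" if "n > M" for n
    using M(2)[OF that] w_le[of n] f by (metis le_neq_implies_less less_imp_le order_refl)
  then have falling: "v (n + 1) + J (n + 1) \<le> v n + J n" if "n > M" for n
    using conservation[of "n + 1"] that by (force simp: v_def)
  have "int K \<le> v n + J n" if "n > M" for n
  proof -
    have "int K \<le> v (max n N - int k) + J (max n N - int k)" if "max n N - int k > M" for k
      using that
    proof (induction k)
      case 0
      show ?case using NK f(3) by (simp add: v_def J_def)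
    next
      case (Suc k)
      then show ?case using falling[of "max n N - int (Suc k)"] by simp
    qed
    from this[of "nat (max n N - n)"] that show ?thesis by simp
  qed
  then have at_front: "int K \<le> v (M + 1) + J (M + 1)" by simp
  moreover have "2 * J (M + 1) \<le> v (M + 2) - v (M + 1)"
    using double_half_capped_le[of \<delta> "v (M + 2) - v (M + 1)"] by (simp add: J_def add.assoc)
  ultimately have "v (M + 1) = int K"
    using v_le[of "M + 1"] v_le[of "M + 2"] by linarith
  then have "int K \<le> int (w M) + half_capped \<delta> (int K - int (f (w M)))"
    using conservation[of "M + 1"] at_front by (simp add: J_def v_def)
  then show ?thesis using M(1) by blast
qed

section \<open>Building the profile backwards\<close>

text \<open>Here \<open>c\<close> is the reacted value to the right of \<open>x\<close>, and the invariant says that the flux arriving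
  at \<open>x\<close> from the right does not exceed \<open>x - f x\<close>. At \<open>y = x\<close> the left side of the flux equation is
  \<open>x\<close>, so this is exactly what the intermediate value argument needs. That a flux is at most half
  of the height difference gives back the invariant for \<open>y\<close>.\<close>

lemma backward_step:
  fixes f :: "nat \<Rightarrow> nat" and c :: int
  assumes "mono f" "f 0 = 0" and "int (f x) \<le> c"
    and invariant: "half_capped \<delta> (c - int (f x)) \<le> int x - int (f x)"
  shows "\<exists>y\<le>x. int y + half_capped \<delta> (int (f x) - int (f y))
      = int (f x) + half_capped \<delta> (c - int (f x))
    \<and> half_capped \<delta> (int (f x) - int (f y)) \<le> int y - int (f y)"
proof -
  have nonneg: "0 \<le> half_capped \<delta> (c - int (f x))"
    using assms(3) by (intro half_capped_nonneg) simp
  have "\<exists>y\<le>x. int y + half_capped \<delta> (int (f x) - int (f y))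
      = int (f x) + half_capped \<delta> (c - int (f x))"
  proof (rule flux_equation_solvable)
    show "half_capped \<delta> (int (f x) - int (f 0)) \<le> int (f x) + half_capped \<delta> (c - int (f x))"
      using double_half_capped_le[of \<delta> "int (f x)"] nonneg \<open>f 0 = 0\<close> by simp
  qed (use assms in auto)
  then obtain y where y: "y \<le> x" "int y + half_capped \<delta> (int (f x) - int (f y))
      = int (f x) + half_capped \<delta> (c - int (f x))"
    by blast
  moreover have "half_capped \<delta> (int (f x) - int (f y)) \<le> int y - int (f y)"
    using y(2) nonneg double_half_capped_le[of \<delta> "int (f x) - int (f y)"] by linarith
  ultimately show ?thesis by blast
qed

text \<open>The sequence lists the profile from right to left. Its second entry need not be the given \<open>p\<close>:
  the flux equation at \<open>K\<close> must hold with equality, and lowering \<open>p\<close> achieves this.\<close>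

lemma backward_sequence_exists:
  fixes f :: "nat \<Rightarrow> nat"
  assumes "mono f" "f 0 = 0" "f K = K" "0 < K" "p < K"
    and "int K \<le> int p + half_capped \<delta> (int K - int (f p))"
  shows "\<exists>W :: nat \<Rightarrow> nat. W 0 = K \<and> W 1 \<le> p \<and> 0 < W 1 \<and> (\<forall>k. W (Suc k) \<le> W k)
    \<and> int (W 1) + half_capped \<delta> (int K - int (f (W 1))) = int K
    \<and> (\<forall>k. int (W (k + 2)) + half_capped \<delta> (int (f (W (k + 1))) - int (f (W (k + 2))))
        = int (f (W (k + 1))) + half_capped \<delta> (int (f (W k)) - int (f (W (k + 1)))))"
proof -
  have "half_capped \<delta> (int K - int (f 0)) \<le> int K"
    using double_half_capped_le[of \<delta> "int K"] \<open>f 0 = 0\<close> by simp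
  then obtain q where q: "q \<le> p" "int q + half_capped \<delta> (int K - int (f q)) = int K"
    using flux_equation_solvable[OF \<open>mono f\<close>, of \<delta> "int K" "int K" p] assms by blast
  have "q > 0"
    using q(2) double_half_capped_le[of \<delta> "int K"] \<open>f 0 = 0\<close> \<open>0 < K\<close> by (cases "q = 0") auto
  \<comment> \<open>A state is a pair of neighbours: a value together with the value on its right.\<close>
  define ok where "ok s \<longleftrightarrow> snd s \<le> fst s \<and>
      half_capped \<delta> (int (f (fst s)) - int (f (snd s))) \<le> int (snd s) - int (f (snd s))"
    for s :: "nat \<times> nat"
  define next_state where "next_state s s' \<longleftrightarrow> fst s' = snd s \<and>
      int (snd s') + half_capped \<delta> (int (f (snd s)) - int (f (snd s')))
        = int (f (snd s)) + half_capped \<delta> (int (f (fst s)) - int (f (snd s)))"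
    for s s' :: "nat \<times> nat"
  have "\<exists>s. \<forall>n. (ok (s n) \<and> (n = 0 \<longrightarrow> s n = (K, q))) \<and> next_state (s n) (s (Suc n))"
  proof (rule dependent_nat_choice)
    have "ok (K, q)"
      using q \<open>p < K\<close> \<open>f K = K\<close> double_half_capped_le[of \<delta> "int K - int (f q)"]
      by (simp add: ok_def)
    then show "\<exists>s. ok s \<and> (0 = (0 :: nat) \<longrightarrow> s = (K, q))" by simp
  next
    fix s and n :: nat
    assume "ok s \<and> (n = 0 \<longrightarrow> s = (K, q))"
    then have s: "snd s \<le> fst s" "half_capped \<delta> (int (f (fst s)) - int (f (snd s)))
        \<le> int (snd s) - int (f (snd s))"
      by (auto simp: ok_def)
    have "int (f (snd s)) \<le> int (f (fst s))"
      using monoD[OF \<open>mono f\<close> s(1)] by simp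
    from backward_step[OF \<open>mono f\<close> \<open>f 0 = 0\<close> this s(2)]
    obtain y where "ok (snd s, y)" "next_state s (snd s, y)"
      by (auto simp: ok_def next_state_def)
    then show "\<exists>s'. (ok s' \<and> (Suc n = 0 \<longrightarrow> s' = (K, q))) \<and> next_state s s'"
      by blast
  qed
  then obtain s where s: "\<And>n. ok (s n)" "s 0 = (K, q)" "\<And>n. next_state (s n) (s (Suc n))"
    by blast
  define W where "W k = fst (s k)" for k
  have snd_s: "snd (s k) = W (Suc k)" for k
    using s(3)[of k] by (simp add: W_def next_state_def)
  have "W 0 = K" "W 1 = q"
    using s(2) snd_s[of 0] by (simp_all add: W_def)
  moreover have "W (Suc k) \<le> W k" for k
    using s(1)[of k] snd_s[of k] by (simp add: ok_def W_def)
  moreover have "int (W (k + 2)) + half_capped \<delta> (int (f (W (k + 1))) - int (f (W (k + 2))))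
      = int (f (W (k + 1))) + half_capped \<delta> (int (f (W k)) - int (f (W (k + 1))))" for k
    using s(3)[of k] snd_s[of k] snd_s[of "Suc k"] by (simp add: next_state_def flip: W_def)
  ultimately show ?thesis using q \<open>q > 0\<close> by (intro exI[of _ W]) simp
qed

text \<open>Two equal steps in a row have zero fluxes, so the repeated value would be a fixed point of
  \<open>f\<close>, while \<open>f\<close> lowers every positive entry after the first.\<close>

lemma backward_sequence_reaches_0:
  fixes f W :: "nat \<Rightarrow> nat"
  assumes decreasing: "\<And>k. W (Suc k) \<le> W k"
    and below: "\<And>k. 0 < W (Suc k) \<Longrightarrow> f (W (Suc k)) < W (Suc k)"
    and flux: "\<And>k. int (W (k + 2)) + half_capped \<delta> (int (f (W (k + 1))) - int (f (W (k + 2))))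
        = int (f (W (k + 1))) + half_capped \<delta> (int (f (W k)) - int (f (W (k + 1))))"
  shows "\<exists>k. W k = 0"
proof -
  have drop: "W (k + 3) < W (k + 1)" if "0 < W (k + 1)" for k
  proof (rule ccontr)
    assume "\<not> W (k + 3) < W (k + 1)"
    moreover have "W (k + 3) \<le> W (k + 2)" "W (k + 2) \<le> W (k + 1)"
      using decreasing[of "k + 2"] decreasing[of "k + 1"] by (simp_all add: eval_nat_numeral)
    ultimately have "W (k + 3) = W (k + 1)" "W (k + 2) = W (k + 1)" by auto
    then have "W (k + 1) = f (W (k + 1))"
      using flux[of "k + 1"] by (simp add: eval_nat_numeral)
    then show False using below[of k] that by simp
  qed
  have "W (2 * k + 1) = 0 \<or> W (2 * k + 1) + k \<le> W 1" for k
  proof (induction k)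
    case (Suc k)
    have "W (2 * k + 3) \<le> W (2 * k + 1)"
      using decreasing[of "2 * k + 1"] decreasing[of "2 * k + 2"] by (simp add: eval_nat_numeral)
    then have "W (2 * k + 3) = 0 \<or> W (2 * k + 3) + Suc k \<le> W 1"
      using Suc drop[of "2 * k"] by linarith
    moreover have "2 * Suc k + 1 = 2 * k + 3" by simp
    ultimately show ?case by metis
  qed simp
  from this[of "Suc (W 1)"] show ?thesis by auto
qed

text \<open>This is the sufficiency argument. The backward sequence is reversed and extended by \<open>K\<close> to the
  right; its first zero is put at the origin, which makes \<open>w 1\<close> positive.\<close>

lemma wave_exists:
  assumes "\<delta> \<ge> 1" and "a < K" and bis: "bistable_reaction a K f"
    and "p < a" and "int K \<le> int p + half_capped \<delta> (int K - int (f p))"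
  shows "\<exists>w. wave_profile K w \<and> (\<forall>n. ca_update \<delta> f w n = int (w (n - 1)))"
proof -
  have f: "mono f" "f 0 = 0" "f K = K" "\<And>u. 0 < u \<Longrightarrow> u < a \<Longrightarrow> f u < u"
    using bis by (auto simp: bistable_reaction_def)
  have "0 < K" "p < K" using \<open>p < a\<close> \<open>a < K\<close> by auto
  from backward_sequence_exists[OF f(1-3) this assms(5)]
  obtain W where W: "W 0 = K" "W 1 \<le> p" "0 < W 1" "\<And>k. W (Suc k) \<le> W k"
      "int (W 1) + half_capped \<delta> (int K - int (f (W 1))) = int K"
    and flux: "\<And>k. int (W (k + 2)) + half_capped \<delta> (int (f (W (k + 1))) - int (f (W (k + 2))))
        = int (f (W (k + 1))) + half_capped \<delta> (int (f (W k)) - int (f (W (k + 1))))"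
    by blast
  have W_anti: "W k \<le> W j" if "j \<le> k" for j k
    using W(4) that by (rule lift_Suc_antimono_le)
  have "f (W (Suc k)) < W (Suc k)" if "0 < W (Suc k)" for k
    using W_anti[of 1 "Suc k"] W(2) \<open>p < a\<close> that by (intro f(4)) auto
  from backward_sequence_reaches_0[OF W(4) this flux]
  have "\<exists>k. W k = 0" .
  define Z where "Z = (LEAST k. W k = 0)"
  have Z: "W Z = 0" "\<And>k. k < Z \<Longrightarrow> 0 < W k"
    using LeastI_ex[OF \<open>\<exists>k. W k = 0\<close>] not_less_Least unfolding Z_def by auto
  have "Z \<noteq> 0" using W(1) Z(1) \<open>0 < K\<close> by (intro notI) simp
  moreover have "Z \<noteq> 1" using W(3) Z(1) by (intro notI) simp
  ultimately have "Z \<ge> 2" by simp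
  define w where "w n = W (nat (int Z - n))" for n
  have w_mono: "w m \<le> w n" if "m \<le> n" for m n
    using that by (simp add: w_def W_anti)
  have w_nonpos: "w n = 0" if "n \<le> 0" for n
    using W_anti[of Z "nat (int Z - n)"] Z(1) that by (simp add: w_def)
  have w_right: "w n = K" if "n \<ge> int Z" for n
    using W(1) that by (simp add: w_def)
  have "wave_profile K w"
    unfolding wave_profile_def
  proof (intro exI[of _ "int Z"] conjI allI impI)
    have "w 1 = W (Z - 1)" using \<open>Z \<ge> 2\<close> by (simp add: w_def nat_diff_distrib)
    then show "w 0 < w 1" using Z(2)[of "Z - 1"] w_nonpos[of 0] \<open>Z \<ge> 2\<close> by simp
    show "w (int Z - 1) < w (int Z)"
      using W(1,2) \<open>p < K\<close> by (simp add: w_def)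
  qed (use \<open>Z \<ge> 2\<close> w_mono w_nonpos w_right in auto)
  moreover have "ca_update \<delta> f w n = int (w (n - 1))" for n
  proof -
    have update: "ca_update \<delta> f w n = int (f (w n))
        + half_capped \<delta> (int (f (w (n + 1))) - int (f (w n)))
        - half_capped \<delta> (int (f (w n)) - int (f (w (n - 1))))"
      using ca_update_eq_half_capped[OF \<open>\<delta> \<ge> 1\<close>] monoD[OF f(1) w_mono] by simp
    consider "n > int Z" | "n = int Z" | "n < int Z" by linarith
    then show ?thesis
    proof cases
      case 1
      then show ?thesis using update w_right f(3) by simp
    next
      case 2
      have "w (n - 1) = W 1" using 2 by (simp add: w_def)
      then show ?thesis using update W(5) w_right f(3) 2 by simp
    next
      case 3
      define k where "k = nat (int Z - n - 1)"
      have "w (n - 1) = W (k + 2)" "w n = W (k + 1)" "w (n + 1) = W k"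
        unfolding w_def k_def using 3 by (auto intro!: arg_cong[of _ _ W])
      then show ?thesis using update flux[of k] by simp
    qed
  qed
  ultimately show ?thesis by blast
qed

section \<open>The characterization\<close>

theorem theorem3p7:
  fixes \<delta> a K :: nat and f :: "nat \<Rightarrow> nat"
  assumes "\<delta> \<ge> 1"
    and "2 \<le> a" and "a + 2 \<le> K"
    and "bistable_reaction a K f"
  shows "(\<exists>w :: int \<Rightarrow> nat. wave_profile K w \<and>
            (\<forall>n. ca_update \<delta> f w n = int (w (n - 1))))
     \<longleftrightarrow>
         real a > real K / 2 \<and>
         (\<exists>p :: nat. real K / 2 \<le> real p \<and> p < a \<and>
            int \<delta> \<ge> int K - int p \<and>
            int (f p) \<le> 2 * int p - int K)"
proof -
  have "0 < a" "a < K" using assms(2,3) by auto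
  then have "(\<exists>w :: int \<Rightarrow> nat. wave_profile K w \<and> (\<forall>n. ca_update \<delta> f w n = int (w (n - 1))))
      \<longleftrightarrow> (\<exists>p<a. int K \<le> int p + half_capped \<delta> (int K - int (f p)))"
    using wave_has_front_value[OF assms(1) _ _ assms(4)] wave_exists[OF assms(1) _ assms(4)]
    by blast
  moreover have "real a > real K / 2" if "p < a" "real K / 2 \<le> real p" for p
    using that by linarith
  ultimately show ?thesis unfolding front_value_iff by blast
qed

end
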